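(* Let $(M,d,m)$ be a metric measure space. (i) If $(M,d,m)$ satisfies the curvature-dimension condition $\mathsf{CD}(K,N)$ for given numbers $K,N\in\mathbb{R}$ with $N\ge1$, then it satisfies the reduced curvature-dimension condition $\mathsf{CD}^*(K,N)$. (ii) If $(M,d,m)$ satisfies $\mathsf{CD}^*(K,N)$ for some $K>0$ and $N\ge 1$, then it satisfies $\mathsf{CD}(K^*,N)$ for $K^*=\frac{K(N-1)}{N}$.
   Context: A metric measure space $(M,d,m)$ consists of a complete separable metric space $(M,d)$ and a locally finite Borel measure $m$ (for every $x\in M$, $m(B_r(x))<\infty$ for all sufficiently small $r>0$). $\mathcal{P}_2(M,d)$ is the space of Borel probability measures with finite second moment, with the $L_2$-Wasserstein distance $d_W(\mu,\nu)=\inf_q\big(\int d^2\,dq\big)^{1/2}$ over couplings $q$ of $\mu,\nu$; optimal couplings are the minimizers. $\mathcal{P}_\infty(M,d,m)$ is the subspace of $m$-absolutely continuous probability measures with bounded support. A geodesic $\Gamma:[0,1]\to\mathcal{P}_\infty(M,d,m)$ is a curve with $d_W(\Gamma(s),\Gamma(t))=|s-t|\,d_W(\Gamma(0),\Gamma(1))$. For $\nu=\rho m$ and $N'\ge 1$, $S_{N'}(\nu|m):=-\int_M\rho^{1-1/N'}\,dm$ (with $0^0=0$ when $N'=1$). For $\theta\ge 0$: $\mathfrak{S}_k(\theta)=\frac{\sin(\sqrt{k}\theta)}{\sqrt{k}\theta}$ if $k>0$, $=1$ if $k=0$, $=\frac{\sinh(\sqrt{-k}\theta)}{\sqrt{-k}\theta}$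 if $k<0$ (value $1$ at $\theta=0$). For $t\in[0,1]$: $\sigma^{(t)}_{K,N}(\theta)=\infty$ if $K\theta^2\ge N\pi^2$, and $\sigma^{(t)}_{K,N}(\theta)=t\,\frac{\mathfrak{S}_{K/N}(t\theta)}{\mathfrak{S}_{K/N}(\theta)}$ otherwise. Further $\tau^{(t)}_{K,N}(\theta):=t^{1/N}\sigma^{(t)}_{K,N-1}(\theta)^{1-1/N}$ for $N>1$; for $N=1$, $\tau^{(t)}_{K,1}(\theta)=t$ if $K\theta^2\le0$ and $=\infty$ if $K\theta^2>0$. $\mathsf{CD}^*(K,N)$: for all $\nu_0=\rho_0m,\nu_1=\rho_1m\in\mathcal{P}_\infty(M,d,m)$ there exist an optimal coupling $q$ of $\nu_0,\nu_1$ and a geodesic $\Gamma:[0,1]\to\mathcal{P}_\infty(M,d,m)$ connecting them such that for all $t\in[0,1]$ and all $N'\ge N$, $$S_{N'}(\Gamma(t)|m)\le-\int_{M\times M}\Big[\sigma^{(1-t)}_{K,N'}(d(x_0,x_1))\rho_0^{-1/N'}(x_0)+\sigma^{(t)}_{K,N'}(d(x_0,x_1))\rho_1^{-1/N'}(x_1)\Big]dq(x_0,x_1).$$ $\mathsf{CD}(K,N)$: the same condition with $\sigma^{(1-t)}_{K,N'},\sigma^{(t)}_{K,N'}$ replaced by $\tau^{(1-t)}_{K,N'},\tau^{(t)}_{K,N'}$. *)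

theory Defs
  imports "HOL-Probability.Probability"
begin

text \<open>The complete separable metric space \<open>M\<close> is a type of class \<open>polish_space\<close>,
  with \<open>d = dist\<close>; the measure \<open>m\<close> lives on its Borel sigma-algebra.\<close>

definition metric_measure_space :: "'a::polish_space measure \<Rightarrow> bool" where
  "metric_measure_space m \<longleftrightarrow>
     sets m = sets borel \<and>
     (\<forall>x. \<forall>\<^sub>F r in at_right 0. emeasure m (ball x r) < \<infinity>)"

definition P2 :: "'a::polish_space measure set" where
  "P2 = {\<mu>. prob_space \<mu> \<and> sets \<mu> = sets borel \<and>
            (\<exists>z. (\<integral>\<^sup>+ x. ennreal ((dist z x)\<^sup>2) \<partial>\<mu>) < \<infinity>)}"

definition couplings ::
    "'a::polish_space measure \<Rightarrow> 'a measure \<Rightarrow> ('a \<times> 'a) measure set" where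
  "couplings \<mu> \<nu> = {q. prob_space q \<and> sets q = sets borel \<and>
                       distr q borel fst = \<mu> \<and> distr q borel snd = \<nu>}"

definition transport_cost :: "('a::polish_space \<times> 'a) measure \<Rightarrow> ennreal" where
  "transport_cost q = (\<integral>\<^sup>+ p. ennreal ((dist (fst p) (snd p))\<^sup>2) \<partial>q)"

text \<open>The square root is taken after the infimum. The result is meaningful on \<open>P2\<close>,
  where the infimum is finite (\<open>enn2real\<close> sends \<open>\<infinity>\<close> to \<open>0\<close>).\<close>

definition wasserstein :: "'a::polish_space measure \<Rightarrow> 'a measure \<Rightarrow> real" where
  "wasserstein \<mu> \<nu> = sqrt (enn2real (INF q\<in>couplings \<mu> \<nu>. transport_cost q))"

definition optimal_coupling ::
    "('a::polish_space \<times> 'a) measure \<Rightarrow> 'a measure \<Rightarrow> 'a measure \<Rightarrow> bool" where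
  "optimal_coupling q \<mu> \<nu> \<longleftrightarrow>
     q \<in> couplings \<mu> \<nu> \<and> (\<forall>q'\<in>couplings \<mu> \<nu>. transport_cost q \<le> transport_cost q')"

definition measure_support :: "'a::polish_space measure \<Rightarrow> 'a set" where
  "measure_support \<mu> = {x. \<forall>r>0. emeasure \<mu> (ball x r) > 0}"

definition P_inf :: "'a::polish_space measure \<Rightarrow> 'a measure set" where
  "P_inf m = {\<mu> \<in> P2. absolutely_continuous m \<mu> \<and> bounded (measure_support \<mu>)}"

definition geodesic_in :: "'a::polish_space measure set \<Rightarrow> (real \<Rightarrow> 'a measure) \<Rightarrow> bool" where
  "geodesic_in P \<Gamma> \<longleftrightarrow>
     (\<forall>t\<in>{0..1}. \<Gamma> t \<in> P) \<and>
     (\<forall>s\<in>{0..1}. \<forall>t\<in>{0..1}.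
        wasserstein (\<Gamma> s) (\<Gamma> t) = \<bar>s - t\<bar> * wasserstein (\<Gamma> 0) (\<Gamma> 1))"

text \<open>The density \<open>\<rho>\<close> of \<open>\<nu> = \<rho> m\<close>; it is determined, and finite, up to an \<open>m\<close>-null set.\<close>

definition rho :: "'a measure \<Rightarrow> 'a measure \<Rightarrow> 'a \<Rightarrow> real" where
  "rho m \<nu> x = enn2real (RN_deriv m \<nu> x)"

text \<open>The value may be \<open>-\<infinity>\<close>, since bounded sets need not have finite \<open>m\<close>-measure.
  The convention \<open>0\<^sup>0 = 0\<close> for \<open>N' = 1\<close> is built into \<open>powr\<close>.\<close>

definition renyi_entropy :: "real \<Rightarrow> 'a measure \<Rightarrow> 'a measure \<Rightarrow> ereal" where
  "renyi_entropy N' m \<nu> =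
     - enn2ereal (\<integral>\<^sup>+ x. ennreal (rho m \<nu> x powr (1 - 1 / N')) \<partial>m)"

definition frakS :: "real \<Rightarrow> real \<Rightarrow> real" where
  "frakS k \<theta> =
     (if \<theta> = 0 \<or> k = 0 then 1
      else if k > 0 then sin (sqrt k * \<theta>) / (sqrt k * \<theta>)
      else sinh (sqrt (- k) * \<theta>) / (sqrt (- k) * \<theta>))"

definition sigma_coeff :: "real \<Rightarrow> real \<Rightarrow> real \<Rightarrow> real \<Rightarrow> ennreal" where
  "sigma_coeff K N t \<theta> =
     (if K * \<theta>\<^sup>2 \<ge> N * pi\<^sup>2 then \<infinity>
      else ennreal (t * (frakS (K / N) (t * \<theta>) / frakS (K / N) \<theta>)))"

text \<open>The product \<open>t\<^bsup>1/N\<^esup> \<sigma>\<^bsup>1-1/N\<^esup>\<close> is read as \<open>\<infinity>\<close> whenever \<open>\<sigma> = \<infinity>\<close>, also for \<open>t = 0\<close>,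
  in line with the values of \<open>\<sigma>\<close> and of the case \<open>N = 1\<close> at \<open>t = 0\<close>; the library product on
  \<open>ennreal\<close> would give \<open>0 * \<infinity> = 0\<close>. Only \<open>N \<ge> 1\<close> is of interest.\<close>

definition tau_coeff :: "real \<Rightarrow> real \<Rightarrow> real \<Rightarrow> real \<Rightarrow> ennreal" where
  "tau_coeff K N t \<theta> =
     (if N > 1 then
        (if sigma_coeff K (N - 1) t \<theta> = \<infinity> then \<infinity>
         else ennreal (t powr (1 / N) * enn2real (sigma_coeff K (N - 1) t \<theta>) powr (1 - 1 / N)))
      else if K * \<theta>\<^sup>2 \<le> 0 then ennreal t else \<infinity>)"

text \<open>The common form of both conditions, for distortion coefficients \<open>\<beta> K N t \<theta>\<close>.
  The integrand on the right is nonnegative and may be \<open>\<infinity>\<close>, so the inequality is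
  one between extended reals. Since \<open>0 powr a = 0\<close>, the densities with negative exponent
  are given the value \<open>0\<close> where they vanish, but this happens only on a \<open>q\<close>-null set.\<close>

definition curvature_dimension ::
    "(real \<Rightarrow> real \<Rightarrow> real \<Rightarrow> real \<Rightarrow> ennreal) \<Rightarrow> real \<Rightarrow> real \<Rightarrow> 'a::polish_space measure \<Rightarrow> bool"
  where
  "curvature_dimension \<beta> K N m \<longleftrightarrow>
     (\<forall>\<nu>0\<in>P_inf m. \<forall>\<nu>1\<in>P_inf m. \<exists>q \<Gamma>.
        optimal_coupling q \<nu>0 \<nu>1 \<and>
        geodesic_in (P_inf m) \<Gamma> \<and> \<Gamma> 0 = \<nu>0 \<and> \<Gamma> 1 = \<nu>1 \<and>
        (\<forall>t\<in>{0..1}. \<forall>N'\<ge>N.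
           renyi_entropy N' m (\<Gamma> t) \<le>
             - enn2ereal (\<integral>\<^sup>+ (x0, x1).
                   \<beta> K N' (1 - t) (dist x0 x1) * ennreal (rho m \<nu>0 x0 powr (- 1 / N'))
                 + \<beta> K N' t (dist x0 x1) * ennreal (rho m \<nu>1 x1 powr (- 1 / N')) \<partial>q)))"

definition CD_star :: "real \<Rightarrow> real \<Rightarrow> 'a::polish_space measure \<Rightarrow> bool" where
  "CD_star = curvature_dimension sigma_coeff"

definition CD :: "real \<Rightarrow> real \<Rightarrow> 'a::polish_space measure \<Rightarrow> bool" where
  "CD = curvature_dimension tau_coeff"

end

theory Submission
  imports Defs
begin

text \<open>Both implications hold coefficient by coefficient. With \<open>k = K / N\<close>, everything is governed by
  the quotient \<open>\<SS>\<^sub>k(t\<theta>) / \<SS>\<^sub>k(\<theta>)\<close>, and Euler's product for the sine, valid on both sides of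
  \<open>k = 0\<close>, writes it as the product of the factors
  \<open>(1 - k(t\<theta>)\<^sup>2 / (j\<^sup>2\<pi>\<^sup>2)) / (1 - k\<theta>\<^sup>2 / (j\<^sup>2\<pi>\<^sup>2))\<close>. Each factor is increasing and log-convex in \<open>k\<close>,
  and equals \<open>1\<close> at \<open>k = 0\<close>. Log-convexity gives \<open>\<sigma> \<le> \<tau>\<close>, hence (i); monotonicity bounds both
  factors \<open>t\<close> and \<open>\<sigma>\<^bsub>K*,N'-1\<^esub>\<close> of \<open>\<tau>\<^bsub>K*,N'\<^esub>\<close> by \<open>\<sigma>\<^bsub>K,N'\<^esub>\<close>, hence (ii).\<close>

section \<open>Quotients of linear functions\<close>

text \<open>The second derivative is a difference of squares, nonnegative because
  \<open>y / (1 - y * x)\<close> increases in \<open>y\<close>. The condition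
  \<open>a * x < 1\<close> forces \<open>b * x < 1\<close>, so both logarithms have positive
  arguments.\<close>

lemma convex_on_ln_linear_quotient:
  fixes a b :: real
  assumes "0 \<le> b" "b \<le> a"
  shows "convex_on {x. a * x < 1} (\<lambda>x. ln (1 - b * x) - ln (1 - a * x))"
proof (rule f''_ge0_imp_convex)
  show "convex {x. a * x < 1}"
    using convex_halfspace_lt[of a 1] by simp
next
  fix x assume "x \<in> {x. a * x < 1}"
  then have a: "a * x < 1" by simp
  have b: "b * x < 1"
    using a assms by (smt (verit) mult_right_mono mult_nonneg_nonpos)
  show "((\<lambda>x. ln (1 - b * x) - ln (1 - a * x)) has_real_derivative
      a / (1 - a * x) - b / (1 - b * x)) (at x)"
    using a b by (auto intro!: derivative_eq_intros simp: field_simps)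
  show "((\<lambda>x. a / (1 - a * x) - b / (1 - b * x)) has_real_derivative
      (a / (1 - a * x))\<^sup>2 - (b / (1 - b * x))\<^sup>2) (at x)"
    using a b by (auto intro!: derivative_eq_intros simp: power2_eq_square)
  have "b / (1 - b * x) \<le> a / (1 - a * x)"
    using a b assms by (simp add: field_simps)
  then show "0 \<le> (a / (1 - a * x))\<^sup>2 - (b / (1 - b * x))\<^sup>2"
    using a b assms by (simp add: power_mono)
qed

text \<open>This is log-convexity between \<open>0\<close>, where the logarithm of the quotient
  vanishes, and \<open>r\<close>, exponentiated.\<close>

lemma linear_quotient_le_powr:
  fixes a b c r :: real
  assumes "0 \<le> b" "b \<le> a" "a * r < 1" "0 \<le> c" "c \<le> 1"
  shows "(1 - b * (c * r)) / (1 - a * (c * r)) \<le> ((1 - b * r) / (1 - a * r)) powr c"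
proof -
  let ?f = "\<lambda>x. ln (1 - b * x) - ln (1 - a * x)"
  have less: "b * x < 1" if "a * x < 1" for x
    using that assms by (smt (verit) mult_right_mono mult_nonneg_nonpos)
  have ac: "a * (c * r) < 1"
  proof -
    have "c * (a * r) < 1"
      using assms by (smt (verit) mult_left_le_one_le mult_nonneg_nonpos)
    then show ?thesis by (simp add: ac_simps)
  qed
  have pos: "0 < 1 - a * r" "0 < 1 - b * r" "0 < 1 - a * (c * r)" "0 < 1 - b * (c * r)"
    using assms ac less[of r] less[of "c * r"] by auto
  have "?f ((1 - c) *\<^sub>R 0 + c *\<^sub>R r) \<le> (1 - c) * ?f 0 + c * ?f r"
    using assms by (intro convex_onD[OF convex_on_ln_linear_quotient]) auto
  then have "ln ((1 - b * (c * r)) / (1 - a * (c * r))) \<le> ln (((1 - b * r) / (1 - a * r)) powr c)"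
    using pos by (simp add: ln_div ln_powr)
  then show ?thesis
    using pos by (subst (asm) ln_le_cancel_iff) auto
qed

text \<open>After cross-multiplication the terms \<open>a * b * x * y\<close> cancel, leaving
  \<open>0 \<le> (a - b) * (y - x)\<close>.\<close>

lemma linear_quotient_mono:
  fixes a b x y :: real
  assumes "0 \<le> b" "b \<le> a" "a * y < 1" "x \<le> y"
  shows "(1 - b * x) / (1 - a * x) \<le> (1 - b * y) / (1 - a * y)"
proof -
  have "a * x < 1"
    using assms by (smt (verit) mult_left_mono)
  moreover have "0 \<le> (a - b) * (y - x)"
    using assms by simp
  then have "a * x + b * y \<le> a * y + b * x"
    by (simp add: algebra_simps)
  ultimately show ?thesis
    using assms by (simp add: divide_simps) (simp add: algebra_simps)
qed

section \<open>Euler's product for \<open>frakS\<close> and its quotients\<close>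

text \<open>The product formula for the complex sine treats both signs of \<open>k\<close> at once:
  for negative \<open>k\<close> the argument is imaginary, the sine becomes \<open>\<i>\<close>
  times \<open>sinh\<close>, and \<open>\<i>\<close> cancels in the quotient. The factors are
  written as linear functions of \<open>k\<close>, the variable in which they are compared
  later.\<close>

lemma frakS_product:
  "(\<lambda>n. \<Prod>j=1..n. 1 - \<theta>\<^sup>2 / (real j * pi)\<^sup>2 * k) \<longlonglongrightarrow> frakS k \<theta>"
proof -
  define z :: complex where "z = csqrt (of_real k) * of_real \<theta> / of_real pi"
  have z2: "z\<^sup>2 = of_real (k * \<theta>\<^sup>2 / pi\<^sup>2)"
    by (simp add: z_def power_divide power_mult_distrib)
  show ?thesis
  proof (cases "\<theta> = 0 \<or> k = 0")
    case True
    then show ?thesis by (auto simp: frakS_def)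
  next
    case False
    then have z0: "of_real pi * z \<noteq> 0" by (simp add: z_def)
    have "(\<lambda>n. of_real pi * z * (\<Prod>j=1..n. 1 - z\<^sup>2 / of_nat j ^ 2) / (of_real pi * z))
        \<longlonglongrightarrow> sin (of_real pi * z) / (of_real pi * z)"
      by (intro tendsto_divide sin_product_formula_complex tendsto_const z0)
    moreover have "of_real pi * z * (\<Prod>j=1..n. 1 - z\<^sup>2 / of_nat j ^ 2) / (of_real pi * z)
        = complex_of_real (\<Prod>j=1..n. 1 - \<theta>\<^sup>2 / (real j * pi)\<^sup>2 * k)" for n
    proof -
      have "1 - z\<^sup>2 / of_nat j ^ 2 = complex_of_real (1 - \<theta>\<^sup>2 / (real j * pi)\<^sup>2 * k)" for j
        by (simp add: z2 power_mult_distrib mult.commute)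
      then show ?thesis using z0 by simp
    qed
    moreover have "sin (of_real pi * z) / (of_real pi * z) = complex_of_real (frakS k \<theta>)"
    proof (cases "k > 0")
      case True
      then have "of_real pi * z = of_real (sqrt k * \<theta>)"
        by (simp add: z_def csqrt_of_real_nonneg)
      with True False show ?thesis
        by (simp only: sin_of_real of_real_divide[symmetric]) (simp add: frakS_def)
    next
      case k: False
      then have "of_real pi * z = \<i> * of_real (sqrt (- k) * \<theta>)"
        by (simp add: z_def csqrt_of_real_nonpos)
      moreover have "sin (\<i> * complex_of_real x) = \<i> * of_real (sinh x)" for x
        by (simp add: complex_eq_iff Re_sin Im_sin sinh_def field_simps exp_minus)
      ultimately have "sin (of_real pi * z) / (of_real pi * z) =
          complex_of_real (sinh (sqrt (- k) * \<theta>)) / of_real (sqrt (- k) * \<theta>)"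
        by (simp only:) simp
      then show ?thesis
        using k False by (simp add: frakS_def)
    qed
    ultimately have "(\<lambda>n. complex_of_real (\<Prod>j=1..n. 1 - \<theta>\<^sup>2 / (real j * pi)\<^sup>2 * k))
        \<longlonglongrightarrow> complex_of_real (frakS k \<theta>)"
      by simp
    then show ?thesis
      by (simp only: tendsto_of_real_iff)
  qed
qed

lemma frakS_pos:
  assumes "0 \<le> \<theta>" "k * \<theta>\<^sup>2 < pi\<^sup>2"
  shows "0 < frakS k \<theta>"
proof (cases "\<theta> = 0 \<or> k \<le> 0")
  case True
  then show ?thesis
    using assms by (auto simp: frakS_def intro!: divide_pos_pos)
next
  case False
  then have "(sqrt k * \<theta>)\<^sup>2 < pi\<^sup>2"
    using assms by (simp add: power_mult_distrib)
  then have "sqrt k * \<theta> < pi"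
    using power_less_imp_less_base[of "sqrt k * \<theta>" 2 pi] by simp
  then show ?thesis
    using False assms by (auto simp: frakS_def intro!: divide_pos_pos sin_gt_zero)
qed

definition frakS_ratio :: "real \<Rightarrow> real \<Rightarrow> real \<Rightarrow> real" where
  "frakS_ratio k t \<theta> = frakS k (t * \<theta>) / frakS k \<theta>"

text \<open>As a function of \<open>k\<close> this has the shape
  \<open>(1 - b * k) / (1 - a * k)\<close> of the linear quotients above, with
  \<open>b \<le> a\<close> when \<open>0 \<le> t \<le> 1\<close>.\<close>

definition frakS_factor :: "nat \<Rightarrow> real \<Rightarrow> real \<Rightarrow> real \<Rightarrow> real" where
  "frakS_factor j k t \<theta> =
     (1 - (t * \<theta>)\<^sup>2 / (real j * pi)\<^sup>2 * k) / (1 - \<theta>\<^sup>2 / (real j * pi)\<^sup>2 * k)"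

lemma frakS_ratio_product:
  assumes "0 \<le> \<theta>" "k * \<theta>\<^sup>2 < pi\<^sup>2"
  shows "(\<lambda>n. \<Prod>j=1..n. frakS_factor j k t \<theta>) \<longlonglongrightarrow> frakS_ratio k t \<theta>"
  unfolding frakS_ratio_def frakS_factor_def prod_dividef
  using frakS_pos[OF assms] by (intro tendsto_divide frakS_product) simp

lemma frakS_ratio_zero [simp]: "frakS_ratio 0 t \<theta> = 1"
  by (simp add: frakS_ratio_def frakS_def)

text \<open>These are the side conditions of the linear quotient lemmas. The last is tightest at
  \<open>j = 1\<close>, where it amounts to the assumed bound by \<open>pi\<close> squared.\<close>

lemma factor_coeffs:
  assumes "0 \<le> t" "t \<le> 1" "0 \<le> \<theta>" "k * \<theta>\<^sup>2 < pi\<^sup>2" "1 \<le> j"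
  shows "0 \<le> (t * \<theta>)\<^sup>2 / (real j * pi)\<^sup>2" "(t * \<theta>)\<^sup>2 / (real j * pi)\<^sup>2 \<le> \<theta>\<^sup>2 / (real j * pi)\<^sup>2"
    "\<theta>\<^sup>2 / (real j * pi)\<^sup>2 * k < 1"
proof -
  show "0 \<le> (t * \<theta>)\<^sup>2 / (real j * pi)\<^sup>2" by simp
  show "(t * \<theta>)\<^sup>2 / (real j * pi)\<^sup>2 \<le> \<theta>\<^sup>2 / (real j * pi)\<^sup>2"
    using assms by (intro divide_right_mono power_mono) (auto simp: mult_left_le_one_le)
  have "pi\<^sup>2 \<le> (real j * pi)\<^sup>2"
    using assms by (intro power_mono) auto
  with assms have "\<theta>\<^sup>2 * k < (real j * pi)\<^sup>2"
    by (metis less_le_trans mult.commute)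
  with assms show "\<theta>\<^sup>2 / (real j * pi)\<^sup>2 * k < 1"
    by simp
qed

lemma frakS_factor_nonneg:
  assumes "0 \<le> t" "t \<le> 1" "0 \<le> \<theta>" "k * \<theta>\<^sup>2 < pi\<^sup>2" "1 \<le> j"
  shows "0 \<le> frakS_factor j k t \<theta>"
proof -
  note c = factor_coeffs[OF assms]
  have "(t * \<theta>)\<^sup>2 / (real j * pi)\<^sup>2 * k < 1"
    using c by (smt (verit) mult_right_mono mult_nonneg_nonpos)
  with c show ?thesis
    unfolding frakS_factor_def by (intro divide_nonneg_nonneg) auto
qed

text \<open>The inequality holds factor by factor; nonnegativity carries it to finite products, and
  it survives the limit.\<close>

lemma frakS_ratio_mono:
  assumes "0 \<le> t" "t \<le> 1" "0 \<le> \<theta>" "l * \<theta>\<^sup>2 < pi\<^sup>2" "k \<le> l"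
  shows "frakS_ratio k t \<theta> \<le> frakS_ratio l t \<theta>"
proof -
  have k: "k * \<theta>\<^sup>2 < pi\<^sup>2"
    using assms by (smt (verit) mult_right_mono zero_le_power2)
  have "(\<Prod>j=1..n. frakS_factor j k t \<theta>) \<le> (\<Prod>j=1..n. frakS_factor j l t \<theta>)" for n
  proof (intro prod_mono conjI)
    fix j assume "j \<in> {1..n}"
    then have j: "1 \<le> j" by simp
    show "0 \<le> frakS_factor j k t \<theta>"
      using assms k j by (intro frakS_factor_nonneg)
    show "frakS_factor j k t \<theta> \<le> frakS_factor j l t \<theta>"
      unfolding frakS_factor_def
      using assms factor_coeffs[OF assms(1-4) j] by (intro linear_quotient_mono)
  qed
  then show ?thesis
    using assms k by (intro LIMSEQ_le[OF frakS_ratio_product frakS_ratio_product]) auto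
qed

text \<open>Each factor obeys the bound by log-convexity in \<open>k\<close>, and a fixed exponent
  distributes over finite products. No sign of \<open>k\<close> is assumed.\<close>

lemma frakS_ratio_le_powr:
  assumes "0 \<le> t" "t \<le> 1" "0 \<le> \<theta>" "k * \<theta>\<^sup>2 < pi\<^sup>2" "0 < c" "c \<le> 1"
  shows "frakS_ratio (c * k) t \<theta> \<le> frakS_ratio k t \<theta> powr c"
proof -
  have ck: "c * k * \<theta>\<^sup>2 < pi\<^sup>2"
  proof (cases "0 \<le> k")
    case True
    then have "c * (k * \<theta>\<^sup>2) \<le> k * \<theta>\<^sup>2"
      using assms by (intro mult_left_le_one_le) auto
    with assms show ?thesis by (simp add: mult.assoc)
  next
    case False
    then have "c * k * \<theta>\<^sup>2 \<le> 0"
      using assms by (intro mult_nonpos_nonneg mult_nonneg_nonpos) auto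
    then show ?thesis
      using pi_gt_zero by (smt (verit) zero_less_power)
  qed
  have le: "(\<Prod>j=1..n. frakS_factor j (c * k) t \<theta>) \<le> (\<Prod>j=1..n. frakS_factor j k t \<theta>) powr c" for n
  proof -
    have "(\<Prod>j=1..n. frakS_factor j (c * k) t \<theta>) \<le> (\<Prod>j=1..n. frakS_factor j k t \<theta> powr c)"
    proof (intro prod_mono conjI)
      fix j assume "j \<in> {1..n}"
      then have j: "1 \<le> j" by simp
      show "0 \<le> frakS_factor j (c * k) t \<theta>"
        using assms ck j by (intro frakS_factor_nonneg)
      show "frakS_factor j (c * k) t \<theta> \<le> frakS_factor j k t \<theta> powr c"
        unfolding frakS_factor_def
        using assms factor_coeffs[OF assms(1-4) j] by (intro linear_quotient_le_powr) auto
    qed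
    also have "\<dots> = (\<Prod>j=1..n. frakS_factor j k t \<theta>) powr c"
      by (rule prod_powr_distrib[symmetric])
    finally show ?thesis .
  qed
  \<comment> \<open>Positivity of the limit is not invoked: with exponent \<open>c > 0\<close> and
    nonnegative products, \<open>powr\<close> is continuous even at base \<open>0\<close>.\<close>
  have "(\<lambda>n. (\<Prod>j=1..n. frakS_factor j k t \<theta>) powr c) \<longlonglongrightarrow> frakS_ratio k t \<theta> powr c"
    using assms
    by (intro tendsto_powr' frakS_ratio_product tendsto_const)
      (auto intro!: always_eventually prod_nonneg frakS_factor_nonneg)
  then show ?thesis
    using assms ck le by (intro LIMSEQ_le[OF frakS_ratio_product]) auto
qed

lemma frakS_ratio_nonneg:
  assumes "0 \<le> t" "t \<le> 1" "0 \<le> \<theta>" "k * \<theta>\<^sup>2 < pi\<^sup>2"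
  shows "0 \<le> frakS_ratio k t \<theta>"
  using assms
  by (intro LIMSEQ_le_const[OF frakS_ratio_product])
    (auto intro!: prod_nonneg frakS_factor_nonneg)

section \<open>Comparison of the distortion coefficients\<close>

lemma sigma_coeff_eq_ratio:
  assumes "0 < N" "K * \<theta>\<^sup>2 < N * pi\<^sup>2"
  shows "sigma_coeff K N t \<theta> = ennreal (t * frakS_ratio (K / N) t \<theta>)"
  using assms by (simp add: sigma_coeff_def frakS_ratio_def)

lemma below_pi_sq:
  fixes K N \<theta> :: real
  assumes "0 < N" "K * \<theta>\<^sup>2 < N * pi\<^sup>2"
  shows "K / N * \<theta>\<^sup>2 < pi\<^sup>2"
  using assms by (simp add: pos_divide_less_eq mult.commute)

text \<open>The powers of \<open>t\<close> with exponents \<open>1 / N\<close> and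
  \<open>1 - 1 / N\<close> recombine to \<open>t\<close>, so both coefficients are \<open>t\<close>
  times an expression in \<open>frakS_ratio\<close>.\<close>

lemma tau_coeff_eq_ratio:
  assumes "0 \<le> t" "t \<le> 1" "0 \<le> \<theta>" "1 < N" "K * \<theta>\<^sup>2 < (N - 1) * pi\<^sup>2"
  shows "tau_coeff K N t \<theta> = ennreal (t * frakS_ratio (K / (N - 1)) t \<theta> powr (1 - 1 / N))"
proof -
  have N: "0 < N - 1" using assms by simp
  have r: "0 \<le> frakS_ratio (K / (N - 1)) t \<theta>"
    using assms below_pi_sq[OF N] by (intro frakS_ratio_nonneg) auto
  have "t powr (1 / N) * t powr (1 - 1 / N) = t"
    using assms by (cases "t = 0") (auto simp flip: powr_add)
  then have "t powr (1 / N) * (t * frakS_ratio (K / (N - 1)) t \<theta>) powr (1 - 1 / N)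
      = t * frakS_ratio (K / (N - 1)) t \<theta> powr (1 - 1 / N)"
    using r assms by (simp add: powr_mult flip: mult.assoc)
  with r assms show ?thesis
    by (simp add: tau_coeff_def sigma_coeff_eq_ratio[OF N])
qed

text \<open>For \<open>N > 1\<close>, \<open>K / N\<close> is \<open>1 - 1 / N\<close> times
  \<open>K / (N - 1)\<close>, so log-convexity applies with \<open>c = 1 - 1 / N\<close>. For
  \<open>N = 1\<close> the finite value of \<open>tau_coeff\<close> is \<open>t\<close>, and
  monotonicity against \<open>k = 0\<close> suffices.\<close>

lemma sigma_le_tau:
  assumes "0 \<le> t" "t \<le> 1" "0 \<le> \<theta>" "1 \<le> N"
  shows "sigma_coeff K N t \<theta> \<le> tau_coeff K N t \<theta>"
proof (cases "N = 1")
  case True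
  show ?thesis
  proof (cases "K * \<theta>\<^sup>2 \<le> 0")
    case le: True
    then have lt: "K * \<theta>\<^sup>2 < 1 * pi\<^sup>2"
      using pi_gt_zero by (smt (verit) zero_less_power)
    have "frakS_ratio K t \<theta> \<le> 1"
    \<comment> \<open>At \<open>\<theta> = 0\<close> the case assumption gives no sign for
      \<open>K\<close>, but the ratio is \<open>1\<close>.\<close>
    proof (cases "\<theta> = 0")
      case False
      with le have "K \<le> 0" by (simp add: mult_le_0_iff)
      then show ?thesis
        using frakS_ratio_mono[of t \<theta> 0 K] assms by simp
    qed (simp add: frakS_ratio_def frakS_def)
    then have "t * frakS_ratio K t \<theta> \<le> t"
      using assms by (simp add: mult_left_le)
    then show ?thesis
      using True le sigma_coeff_eq_ratio[OF _ lt] by (simp add: tau_coeff_def ennreal_leI)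
  qed (simp add: tau_coeff_def True)
next
  case False
  with assms have N: "1 < N" by simp
  show ?thesis
  proof (cases "K * \<theta>\<^sup>2 < (N - 1) * pi\<^sup>2")
    case lt: True
    \<comment> \<open>As \<open>\<theta>\<close> grows, \<open>tau_coeff\<close> becomes infinite no
      later than \<open>sigma_coeff\<close>.\<close>
    have "(N - 1) * pi\<^sup>2 \<le> N * pi\<^sup>2"
      by (intro mult_right_mono) auto
    with lt have lt': "K * \<theta>\<^sup>2 < N * pi\<^sup>2" by linarith
    have N1: "0 < N - 1" using N by simp
    have "K / N = (1 - 1 / N) * (K / (N - 1))"
      using N by (simp add: field_simps)
    then have "frakS_ratio (K / N) t \<theta> \<le> frakS_ratio (K / (N - 1)) t \<theta> powr (1 - 1 / N)"
      using assms N below_pi_sq[OF N1 lt] by (simp only:) (intro frakS_ratio_le_powr, auto)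
    moreover have "sigma_coeff K N t \<theta> = ennreal (t * frakS_ratio (K / N) t \<theta>)"
      using N lt' by (intro sigma_coeff_eq_ratio) auto
    ultimately show ?thesis
      unfolding tau_coeff_eq_ratio[OF assms(1-3) N lt]
      using assms by (simp only:) (intro ennreal_leI mult_left_mono)
  next
    case False
    then have "sigma_coeff K (N - 1) t \<theta> = \<infinity>"
      by (simp only: sigma_coeff_def not_less if_True)
    then show ?thesis
      using N by (simp add: tau_coeff_def)
  qed
qed

text \<open>Where \<open>sigma_coeff\<close> is finite, the curvature parameter
  \<open>K * (N - 1) / N / (N' - 1)\<close> is at most \<open>K / N'\<close> when
  \<open>N' > 1\<close>, so the ratio in \<open>tau_coeff\<close> is at most \<open>?R\<close>.
  Since \<open>K > 0\<close> makes \<open>?R\<close> at least \<open>1\<close>, raising the exponent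
  \<open>1 - 1 / N'\<close> to \<open>1\<close> only increases the bound.\<close>

lemma tau_le_sigma:
  assumes "0 \<le> t" "t \<le> 1" "0 \<le> \<theta>" "1 \<le> N" "N \<le> N'" "0 < K"
  shows "tau_coeff (K * (N - 1) / N) N' t \<theta> \<le> sigma_coeff K N' t \<theta>"
proof (cases "K * \<theta>\<^sup>2 < N' * pi\<^sup>2")
  case lt: True
  let ?K = "K * (N - 1) / N" and ?R = "frakS_ratio (K / N') t \<theta>"
  have N': "0 < N'" using assms by simp
  note s = sigma_coeff_eq_ratio[OF N' lt] and lt1 = below_pi_sq[OF N' lt]
  have R1: "1 \<le> ?R"
    using frakS_ratio_mono[of t \<theta> "K / N'" 0] assms lt1 by simp
  show ?thesis
  \<comment> \<open>Here \<open>N = 1\<close> as well, so the new curvature bound is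
    \<open>0\<close> and \<open>tau_coeff\<close> equals \<open>t\<close>.\<close>
  proof (cases "N' = 1")
    case True
    then show ?thesis
      using assms R1 s by (simp add: tau_coeff_def ennreal_leI mult_le_cancel_left1)
  next
    case False
    with assms have N1: "1 < N'" by simp
    \<comment> \<open>Monotonicity of \<open>(x - 1) / x\<close> lets one bound defined from
      \<open>N\<close> serve every \<open>N' \<ge> N\<close>.\<close>
    have "(N - 1) / N \<le> (N' - 1) / N'"
      using assms by (simp add: field_simps)
    then have "K * ((N - 1) / N) \<le> K * ((N' - 1) / N')"
      using assms by (intro mult_left_mono) auto
    then have K: "?K \<le> (N' - 1) * (K / N')"
      by (simp add: ac_simps)
    have "?K * \<theta>\<^sup>2 \<le> (N' - 1) * (K / N' * \<theta>\<^sup>2)"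
      using mult_right_mono[OF K, of "\<theta>\<^sup>2"] by (simp add: mult.assoc)
    also have "\<dots> < (N' - 1) * pi\<^sup>2"
      using lt1 N1 by (intro mult_strict_left_mono) auto
    finally have lt': "?K * \<theta>\<^sup>2 < (N' - 1) * pi\<^sup>2" .
    have N1': "0 < N' - 1" using N1 by simp
    have "?K / (N' - 1) \<le> K / N'"
      using K N1' by (simp only: pos_divide_le_eq mult.commute)
    then have "frakS_ratio (?K / (N' - 1)) t \<theta> \<le> ?R"
      using assms lt1 by (intro frakS_ratio_mono)
    moreover have "0 \<le> frakS_ratio (?K / (N' - 1)) t \<theta>"
      using assms below_pi_sq[OF N1' lt'] by (intro frakS_ratio_nonneg)
    ultimately have "frakS_ratio (?K / (N' - 1)) t \<theta> powr (1 - 1 / N') \<le> ?R powr (1 - 1 / N')"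
      using N1 by (intro powr_mono2) auto
    also have "\<dots> \<le> ?R powr 1"
      using R1 N1 by (intro powr_mono) auto
    finally have "frakS_ratio (?K / (N' - 1)) t \<theta> powr (1 - 1 / N') \<le> ?R"
      using R1 by simp
    then show ?thesis
      unfolding s tau_coeff_eq_ratio[OF assms(1-3) N1 lt']
      using assms by (intro ennreal_leI mult_left_mono)
  qed
qed (simp add: sigma_coeff_def)

section \<open>From coefficients to curvature-dimension conditions\<close>

text \<open>The same coupling and geodesic serve for both conditions. The coefficients enter through
  the negative of an integral with nonnegative weights, so smaller coefficients give a weaker upper
  bound on the entropy.\<close>

lemma curvature_dimension_mono:
  assumes "curvature_dimension \<beta> K N m"
    and "\<And>N' t \<theta>. N \<le> N' \<Longrightarrow> 0 \<le> t \<Longrightarrow> t \<le> 1 \<Longrightarrow> 0 \<le> \<theta> \<Longrightarrow> \<beta>' K' N' t \<theta> \<le> \<beta> K N' t \<theta>"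
  shows "curvature_dimension \<beta>' K' N m"
  unfolding curvature_dimension_def
proof (intro ballI)
  let ?I = "\<lambda>\<beta> K \<nu>0 \<nu>1 q t N'. \<integral>\<^sup>+ (x0, x1).
      \<beta> K N' (1 - t) (dist x0 x1) * ennreal (rho m \<nu>0 x0 powr (- 1 / N'))
    + \<beta> K N' t (dist x0 x1) * ennreal (rho m \<nu>1 x1 powr (- 1 / N')) \<partial>q"
  fix \<nu>0 \<nu>1 assume \<nu>: "\<nu>0 \<in> P_inf m" "\<nu>1 \<in> P_inf m"
  from assms(1)[unfolded curvature_dimension_def, THEN bspec, OF \<nu>(1), THEN bspec, OF \<nu>(2)]
  obtain q \<Gamma> where q: "optimal_coupling q \<nu>0 \<nu>1" "geodesic_in (P_inf m) \<Gamma>"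
      "\<Gamma> 0 = \<nu>0" "\<Gamma> 1 = \<nu>1"
    and le: "\<forall>t\<in>{0..1}. \<forall>N'\<ge>N.
      renyi_entropy N' m (\<Gamma> t) \<le> - enn2ereal (?I \<beta> K \<nu>0 \<nu>1 q t N')"
    by (elim exE conjE) rule
  have "renyi_entropy N' m (\<Gamma> t) \<le> - enn2ereal (?I \<beta>' K' \<nu>0 \<nu>1 q t N')"
    if "t \<in> {0..1}" "N \<le> N'" for t N'
  proof -
    have "?I \<beta>' K' \<nu>0 \<nu>1 q t N' \<le> ?I \<beta> K \<nu>0 \<nu>1 q t N'"
      using that by (intro nn_integral_mono) (auto intro!: add_mono mult_right_mono assms(2))
    then have "- enn2ereal (?I \<beta> K \<nu>0 \<nu>1 q t N') \<le> - enn2ereal (?I \<beta>' K' \<nu>0 \<nu>1 q t N')"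
      by (simp add: less_eq_ennreal.rep_eq)
    with le[rule_format, OF that] show ?thesis by (rule order_trans)
  qed
  with q show "\<exists>q \<Gamma>. optimal_coupling q \<nu>0 \<nu>1 \<and> geodesic_in (P_inf m) \<Gamma> \<and>
      \<Gamma> 0 = \<nu>0 \<and> \<Gamma> 1 = \<nu>1 \<and> (\<forall>t\<in>{0..1}. \<forall>N'\<ge>N.
        renyi_entropy N' m (\<Gamma> t) \<le> - enn2ereal (?I \<beta>' K' \<nu>0 \<nu>1 q t N'))"
    by blast
qed

theorem proposition2p5:
  fixes m :: "'a::polish_space measure"
  assumes "metric_measure_space m"
  shows "(\<forall>K N :: real. N \<ge> 1 \<longrightarrow> CD K N m \<longrightarrow> CD_star K N m) \<and>
         (\<forall>K N :: real. K > 0 \<longrightarrow> N \<ge> 1 \<longrightarrow> CD_star K N m \<longrightarrow> CD (K * (N - 1) / N) N m)"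
proof (intro conjI allI impI)
  fix K N :: real
  assume "N \<ge> 1" "CD K N m"
  then show "CD_star K N m"
    unfolding CD_def CD_star_def by (elim curvature_dimension_mono) (auto intro: sigma_le_tau)
next
  fix K N :: real
  assume "K > 0" "N \<ge> 1" "CD_star K N m"
  then show "CD (K * (N - 1) / N) N m"
    unfolding CD_def CD_star_def by (elim curvature_dimension_mono) (auto intro: tau_le_sigma)
qed

end
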